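(* Let $X$ be a Banach space and let $\mathcal{T}=\{T_t\}_{t\in\Delta}$ be a $C_0$-semigroup on $X$ indexed by a complex sector $\Delta$. Then the following assertions are equivalent: (1) $\mathcal{T}$ admits a distributionally semi-irregular vector; (2) $\mathcal{T}$ admits a distributionally irregular vector; (3) $\mathcal{T}$ is distributionally chaotic; (4) there is a closed $\mathcal{T}$-invariant subspace $\widetilde{X}$ of $X$ such that the restriction of $\mathcal{T}$ to $\widetilde{X}$ has a dense $G_\delta$ set (in $\widetilde{X}$) of distributionally irregular vectors.
   Context: A complex sector is $\Delta=\Delta(\alpha)=\{re^{i\theta}\in\mathbb{C}: r\ge 0,\ |\theta|\le\alpha\}$ for some $\alpha\in(0,\pi/2)$; it is a semigroup under addition. For $r>0$ put $\Delta_r=\{t\in\Delta:|t|<r\}$. With $\mu$ the (planar) Lebesgue measure, the upper density of a measurable $A\subset\Delta$ is $\overline{\mathrm{dens}}(A)=\limsup_{r\to\infty}\mu(A\cap\Delta_r)/\mu(\Delta_r)$. A family $\{T_t\}_{t\in\Delta}$ of continuous linear operators on a Banach space $X$ is a $C_0$-semigroup if $T_0=I$, $T_tT_s=T_{t+s}$ for all $t,s\in\Delta$, and $\lim_{t\to s}T_tx=T_sx$ in norm for all $s\in\Delta$, $x\in X$. A set $Y\subset X$ is $\mathcal{T}$-invariant if $T_tY\subset Y$ for all $t\in\Delta$. A vector $x\in X$ is distributionally semi-irregular if there are measurable $A,B\subset\Delta$ with $\overline{\mathrm{dens}}(A)=\overline{\mathrm{dens}}(B)=1$ such that $\lim_{t\in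 A,\,|t|\to\infty}\|T_tx\|=0$ and $\liminf_{t\in B,\,|t|\to\infty}\|T_tx\|>0$ (the value $+\infty$ is allowed); it is distributionally irregular if there are such $A,B$ with $\lim_{t\in A,\,|t|\to\infty}\|T_tx\|=0$ and $\lim_{t\in B,\,|t|\to\infty}\|T_tx\|=\infty$. A pair $(x,y)$ is distributionally chaotic if there is $\delta>0$ such that $\overline{\mathrm{dens}}(\{t\in\Delta:\|T_tx-T_ty\|<\varepsilon\})=1$ for every $\varepsilon>0$ and $\overline{\mathrm{dens}}(\{t\in\Delta:\|T_tx-T_ty\|>\delta\})=1$. $\mathcal{T}$ is distributionally chaotic if there is an uncountable set $K\subset X$ such that any two distinct points of $K$ form a distributionally chaotic pair. *)

theory Defs
  imports "HOL-Analysis.Analysis"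
begin

text \<open>
  A Banach space over the real or the complex numbers. The class \<open>banach\<close> only provides the
  underlying real Banach space, so the scalar multiplication is an explicit parameter; by the
  Gelfand--Mazur theorem (up to isometry) the only instances of \<open>real_normed_field\<close> are the reals
  and the complex numbers. The choice of field matters for the linearity of the operators and
  for the notion of subspace.
\<close>

locale banach_over = vector_space smul
  for smul :: "'k::real_normed_field \<Rightarrow> 'a::banach \<Rightarrow> 'a" +
  assumes norm_scale: "norm (smul c x) = norm c * norm x"
    and scale_of_real: "smul (of_real r) x = r *\<^sub>R x"

lemma banach_over_real: "banach_over (scaleR :: real \<Rightarrow> 'a::banach \<Rightarrow> 'a)"
  by unfold_locales (simp_all add: algebra_simps)

lemma banach_over_complex: "banach_over ((*) :: complex \<Rightarrow> complex \<Rightarrow> complex)"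
  by unfold_locales (simp_all add: algebra_simps norm_mult scaleR_conv_of_real)

definition sector :: "real \<Rightarrow> complex set" where
  "sector \<alpha> = {rcis r \<theta> | r \<theta>. r \<ge> 0 \<and> \<bar>\<theta>\<bar> \<le> \<alpha>}"

definition sector_below :: "real \<Rightarrow> real \<Rightarrow> complex set" where
  "sector_below \<alpha> r = {t \<in> sector \<alpha>. norm t < r}"

definition upper_density :: "real \<Rightarrow> complex set \<Rightarrow> ereal" where
  "upper_density \<alpha> A =
     Limsup at_top (\<lambda>r. ereal (measure lebesgue (A \<inter> sector_below \<alpha> r)
                               / measure lebesgue (sector_below \<alpha> r)))"

text \<open>The operators \<open>T t\<close> with \<open>t\<close> outside the sector are irrelevant junk values.\<close>

definition C0_semigroup ::
  "('k::real_normed_field \<Rightarrow> 'a::banach \<Rightarrow> 'a) \<Rightarrow> real \<Rightarrow> (complex \<Rightarrow> 'a \<Rightarrow> 'a) \<Rightarrow> bool" where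
  "C0_semigroup smul \<alpha> T \<longleftrightarrow>
     (\<forall>t\<in>sector \<alpha>. Vector_Spaces.linear smul smul (T t) \<and> continuous_on UNIV (T t)) \<and>
     T 0 = id \<and>
     (\<forall>t\<in>sector \<alpha>. \<forall>s\<in>sector \<alpha>. T t \<circ> T s = T (t + s)) \<and>
     (\<forall>s\<in>sector \<alpha>. \<forall>x. ((\<lambda>t. T t x) \<longlongrightarrow> T s x) (at s within sector \<alpha>))"

definition invariant :: "real \<Rightarrow> (complex \<Rightarrow> 'a \<Rightarrow> 'a) \<Rightarrow> 'a set \<Rightarrow> bool" where
  "invariant \<alpha> T Y \<longleftrightarrow> (\<forall>t\<in>sector \<alpha>. T t ` Y \<subseteq> Y)"

text \<open>The filter for \<open>t \<in> A\<close>, \<open>\<bar>t\<bar> \<rightarrow> \<infinity>\<close>.\<close>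

definition at_infinity_in :: "complex set \<Rightarrow> complex filter" where
  "at_infinity_in A = inf at_infinity (principal A)"

definition dist_semi_irregular ::
  "real \<Rightarrow> (complex \<Rightarrow> 'a \<Rightarrow> 'a) \<Rightarrow> 'a::banach \<Rightarrow> bool" where
  "dist_semi_irregular \<alpha> T x \<longleftrightarrow>
     (\<exists>A B. A \<in> sets lebesgue \<and> A \<subseteq> sector \<alpha> \<and> upper_density \<alpha> A = 1 \<and>
            B \<in> sets lebesgue \<and> B \<subseteq> sector \<alpha> \<and> upper_density \<alpha> B = 1 \<and>
            ((\<lambda>t. norm (T t x)) \<longlongrightarrow> 0) (at_infinity_in A) \<and>
            Liminf (at_infinity_in B) (\<lambda>t. ereal (norm (T t x))) > 0)"

definition dist_irregular ::
  "real \<Rightarrow> (complex \<Rightarrow> 'a \<Rightarrow> 'a) \<Rightarrow> 'a::banach \<Rightarrow> bool" where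
  "dist_irregular \<alpha> T x \<longleftrightarrow>
     (\<exists>A B. A \<in> sets lebesgue \<and> A \<subseteq> sector \<alpha> \<and> upper_density \<alpha> A = 1 \<and>
            B \<in> sets lebesgue \<and> B \<subseteq> sector \<alpha> \<and> upper_density \<alpha> B = 1 \<and>
            ((\<lambda>t. norm (T t x)) \<longlongrightarrow> 0) (at_infinity_in A) \<and>
            filterlim (\<lambda>t. norm (T t x)) at_top (at_infinity_in B))"

definition dist_chaotic_pair ::
  "real \<Rightarrow> (complex \<Rightarrow> 'a \<Rightarrow> 'a) \<Rightarrow> 'a::banach \<Rightarrow> 'a \<Rightarrow> bool" where
  "dist_chaotic_pair \<alpha> T x y \<longleftrightarrow>
     (\<exists>\<delta>>0. (\<forall>\<epsilon>>0. upper_density \<alpha> {t \<in> sector \<alpha>. norm (T t x - T t y) < \<epsilon>} = 1) \<and>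
            upper_density \<alpha> {t \<in> sector \<alpha>. norm (T t x - T t y) > \<delta>} = 1)"

definition dist_chaotic :: "real \<Rightarrow> (complex \<Rightarrow> 'a::banach \<Rightarrow> 'a) \<Rightarrow> bool" where
  "dist_chaotic \<alpha> T \<longleftrightarrow>
     (\<exists>K. uncountable K \<and> (\<forall>x\<in>K. \<forall>y\<in>K. x \<noteq> y \<longrightarrow> dist_chaotic_pair \<alpha> T x y))"

text \<open>
  For an invariant subspace \<open>Y\<close>, an element of \<open>Y\<close> is distributionally irregular for the
  restricted semigroup iff it is so for \<open>T\<close>, the orbits and norms being the same.
\<close>

definition has_dense_gdelta_dist_irregular ::
  "real \<Rightarrow> (complex \<Rightarrow> 'a::banach \<Rightarrow> 'a) \<Rightarrow> 'a set \<Rightarrow> bool" where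
  "has_dense_gdelta_dist_irregular \<alpha> T Y \<longleftrightarrow>
     (\<exists>G. gdelta_in (top_of_set Y) G \<and> (top_of_set Y) closure_of G = Y \<and>
          (\<forall>x\<in>G. dist_irregular \<alpha> T x))"

end

theory Submission
  imports Defs
begin

text \<open>
  Both semi-irregular vectors and differences of distributionally chaotic pairs are vectors \<open>x\<close> such
  that, for some \<open>\<delta> > 0\<close>, \<open>\<parallel>T\<^sub>t x\<parallel>\<close> is below every \<open>\<epsilon> > 0\<close> and above \<open>\<delta>\<close> on sets of times of upper density
  one; conversely, the real multiples of such an \<open>x\<close> form a chaotic set. Given \<open>x\<close>, let \<open>Y\<close> be the
  closure of the subspace of all \<open>y\<close> with \<open>\<parallel>T\<^sub>t y\<parallel> \<le> C \<parallel>T\<^sub>t x\<parallel>\<close> for some \<open>C\<close> and all \<open>t\<close>. In \<open>Y\<close>, the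
  vectors whose orbit is small at most times up to some large radius form a dense open set. So do the
  vectors whose orbit is large at most such times: \<open>Y\<close> contains arbitrarily small vectors \<open>T\<^sub>s x\<close>, whose
  orbits exceed \<open>\<delta>\<close> with upper density one because the density is invariant under translation, and
  suitable multiples of them serve as perturbations. By Baire's theorem the vectors lying in all these
  sets are a dense \<open>G\<^sub>\<delta>\<close> in \<open>Y\<close>, and diagonalising the sets of times shows that they are irregular.
\<close>

section \<open>Geometry and Lebesgue measure of the sector\<close>

text \<open>Monotonicity of \<open>tan\<close> below \<open>pi/2\<close> turns the angle bound into
  a Cartesian inequality. In that form, closedness, stability under addition and the location of
  interior points are immediate.\<close>

lemma sector_eq:
  assumes "0 < \<alpha>" "\<alpha> < pi/2"
  shows "sector \<alpha> = {z. \<bar>Im z\<bar> \<le> tan \<alpha> * Re z}"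
proof (intro set_eqI iffI)
  fix z assume "z \<in> sector \<alpha>"
  then obtain r \<theta> where z: "z = rcis r \<theta>" "r \<ge> 0" "\<bar>\<theta>\<bar> \<le> \<alpha>"
    by (auto simp: sector_def)
  have \<theta>: "\<bar>\<theta>\<bar> < pi/2" using z assms by linarith
  have c: "cos \<theta> > 0" using \<theta> by (intro cos_gt_zero_pi) auto
  have "\<bar>tan \<theta>\<bar> = tan \<bar>\<theta>\<bar>"
    using \<theta> tan_pos_pi2_le[of "\<bar>\<theta>\<bar>"] by (cases "\<theta> \<ge> 0") auto
  also have "\<dots> \<le> tan \<alpha>" using z assms by (intro tan_mono_le) auto
  finally have "\<bar>sin \<theta>\<bar> \<le> tan \<alpha> * cos \<theta>"
    using c by (simp add: tan_def abs_divide field_simps)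
  then show "z \<in> {z. \<bar>Im z\<bar> \<le> tan \<alpha> * Re z}"
    using z mult_left_mono[of "\<bar>sin \<theta>\<bar>" "tan \<alpha> * cos \<theta>" r] by (auto simp: abs_mult mult_ac)
next
  fix z assume "z \<in> {z. \<bar>Im z\<bar> \<le> tan \<alpha> * Re z}"
  then have z: "\<bar>Im z\<bar> \<le> tan \<alpha> * Re z" by simp
  have t: "tan \<alpha> > 0" using assms by (intro tan_gt_zero) auto
  show "z \<in> sector \<alpha>"
  proof (cases "z = 0")
    case True
    then show ?thesis using assms by (auto simp: sector_def intro!: exI[of _ 0])
  next
    case False
    \<comment> \<open>With a nonpositive real part the inequality forces \<open>z = 0\<close>.
      Positivity makes \<open>arctan (Im z / Re z)\<close> the argument of \<open>z\<close>.\<close>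
    have R: "Re z > 0"
    proof (rule ccontr)
      assume "\<not> Re z > 0"
      then have "tan \<alpha> * Re z \<le> 0" using t by (simp add: mult_le_0_iff)
      with z have "Im z = 0" "tan \<alpha> * Re z = 0" by linarith+
      with False t show False by (auto simp: complex_eq_iff)
    qed
    define \<theta> where "\<theta> = arctan (Im z / Re z)"
    have "\<bar>Im z / Re z\<bar> \<le> tan \<alpha>" using z R by (simp add: abs_divide field_simps)
    then have "arctan \<bar>Im z / Re z\<bar> \<le> arctan (tan \<alpha>)" by (simp only: arctan_le_iff)
    then have "\<bar>\<theta>\<bar> \<le> \<alpha>"
      using assms by (simp add: \<theta>_def arctan_tan abs_arctan)
    moreover have "z = rcis (norm z) \<theta>"
    proof -
      have "z = rcis (norm z) (Arg z)" by (simp add: rcis_cmod_Arg)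
      moreover have "Arg z = \<theta>" using R by (simp add: \<theta>_def arg_conv_arctan)
      ultimately show ?thesis by simp
    qed
    ultimately show ?thesis unfolding sector_def by force
  qed
qed

locale complex_sector =
  fixes \<alpha> :: real
  assumes alpha_pos: "0 < \<alpha>" and alpha_less: "\<alpha> < pi / 2"
begin

abbreviation \<Delta> where "\<Delta> \<equiv> sector \<alpha>"
abbreviation \<Delta>\<^sub>r where "\<Delta>\<^sub>r \<equiv> sector_below \<alpha>"
abbreviation \<mu> :: "complex set \<Rightarrow> real" where "\<mu> \<equiv> measure lebesgue"

lemma tan_alpha_pos: "tan \<alpha> > 0"
  using alpha_pos alpha_less by (intro tan_gt_zero) auto

lemma mem_sector_iff: "z \<in> \<Delta> \<longleftrightarrow> \<bar>Im z\<bar> \<le> tan \<alpha> * Re z"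
  using sector_eq[OF alpha_pos alpha_less] by auto

lemma of_real_in_sector: "r \<ge> 0 \<Longrightarrow> of_real r \<in> \<Delta>"
  using tan_alpha_pos by (simp add: mem_sector_iff)

lemma sector_add: "s \<in> \<Delta> \<Longrightarrow> t \<in> \<Delta> \<Longrightarrow> s + t \<in> \<Delta>"
  by (auto simp: mem_sector_iff distrib_left)

lemma sector_scale: "t \<in> \<Delta> \<Longrightarrow> r \<ge> 0 \<Longrightarrow> r *\<^sub>R t \<in> \<Delta>"
  using mult_left_mono[of "\<bar>Im t\<bar>" "tan \<alpha> * Re t" r] by (auto simp: mem_sector_iff abs_mult mult_ac)

lemma closed_sector: "closed \<Delta>"
proof -
  have "\<Delta> = {z. \<bar>Im z\<bar> \<le> tan \<alpha> * Re z}" by (auto simp: mem_sector_iff)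
  then show ?thesis by (auto intro!: closed_Collect_le continuous_intros)
qed

lemma sector_below_eq: "\<Delta>\<^sub>r r = \<Delta> \<inter> ball 0 r"
  by (auto simp: sector_below_def)

lemma lmeasurable_sector_below: "\<Delta>\<^sub>r r \<in> lmeasurable"
  using closed_sector
  by (auto simp: sector_below_eq intro!: bounded_set_imp_lmeasurable bounded_Int)

lemma lmeasurable_Int_sector_below: "A \<in> sets lebesgue \<Longrightarrow> A \<inter> \<Delta>\<^sub>r r \<in> lmeasurable"
  using lmeasurable_sector_below by (metis fmeasurable_Int_fmeasurable inf_commute)

lemma sector_below_scale:
  assumes "c > 0"
  shows "\<Delta>\<^sub>r (c * r) = (*\<^sub>R) c ` \<Delta>\<^sub>r r"
proof (intro set_eqI iffI)
  fix t assume "t \<in> \<Delta>\<^sub>r (c * r)"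
  then have "(1/c) *\<^sub>R t \<in> \<Delta>\<^sub>r r"
    using assms sector_scale[of t "1/c"] by (auto simp: sector_below_def field_simps)
  then show "t \<in> (*\<^sub>R) c ` \<Delta>\<^sub>r r"
    using assms by (intro image_eqI[of _ _ "(1/c) *\<^sub>R t"]) auto
qed (use assms in \<open>auto simp: sector_below_def sector_scale\<close>)

lemma sector_below_affine_image:
  assumes "c > 0"
  shows "(\<lambda>t. c *\<^sub>R t + d) ` \<Delta>\<^sub>r r \<in> lmeasurable"
    and "\<mu> ((\<lambda>t. c *\<^sub>R t + d) ` \<Delta>\<^sub>r r) = c\<^sup>2 * \<mu> (\<Delta>\<^sub>r r)"
proof -
  have "(\<lambda>t. c *\<^sub>R t + d) ` \<Delta>\<^sub>r r = (+) d ` ((*\<^sub>R) c ` \<Delta>\<^sub>r r)"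
    by (auto simp: image_image add.commute)
  then show "(\<lambda>t. c *\<^sub>R t + d) ` \<Delta>\<^sub>r r \<in> lmeasurable"
    using sector_below_scale[OF assms, of r] lmeasurable_sector_below
    by (metis measurable_translation)
  show "\<mu> ((\<lambda>t. c *\<^sub>R t + d) ` \<Delta>\<^sub>r r) = c\<^sup>2 * \<mu> (\<Delta>\<^sub>r r)"
    using measure_lebesgue_affine[of c d "\<Delta>\<^sub>r r"] by simp
qed

lemma measure_sector_below: 
  assumes "r > 0"
  shows "\<mu> (\<Delta>\<^sub>r r) = r\<^sup>2 * \<mu> (\<Delta>\<^sub>r 1)"
  using sector_below_scale[OF assms, of 1] sector_below_affine_image(2)[OF assms, of 0 1] by simp

lemma measure_sector_below_pos: 
  assumes "r > 0"
  shows "\<mu> (\<Delta>\<^sub>r r) > 0"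
proof -
  \<comment> \<open>The strict inequality gives an open subset of the truncated sector; it contains
    \<open>r/2\<close>, hence a whole disc.\<close>
  let ?U = "{z. \<bar>Im z\<bar> < tan \<alpha> * Re z} \<inter> ball 0 r"
  have "open ?U" by (auto intro!: open_Collect_less continuous_intros)
  moreover have "of_real (r/2) \<in> ?U" using assms tan_alpha_pos by simp
  ultimately obtain e where e: "e > 0" "ball (of_real (r/2)) e \<subseteq> ?U"
    by (meson open_contains_ball)
  have "0 < \<mu> (ball (of_real (r/2)) e)"
    using content_ball_pos[OF e(1)] by (simp add: measure_completion)
  also have "\<dots> \<le> \<mu> (\<Delta>\<^sub>r r)"
    using e lmeasurable_sector_below
    by (intro measure_mono_fmeasurable) (auto simp: sector_below_eq mem_sector_iff fmeasurableD)
  finally show ?thesis .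
qed

lemma measure_Int_sector_below_le: "\<mu> (A \<inter> \<Delta>\<^sub>r r) \<le> \<mu> (\<Delta>\<^sub>r r)"
proof (cases "A \<inter> \<Delta>\<^sub>r r \<in> sets lebesgue")
  case True
  then show ?thesis using lmeasurable_sector_below by (intro measure_mono_fmeasurable) auto
\<comment> \<open>A set outside \<open>sets lebesgue\<close> has \<open>measure\<close> 0 by
  convention.\<close>
qed (simp add: measure_notin_sets)

section \<open>Sets of upper density one\<close>

lemma upper_density_eq_1_iff:
  "upper_density \<alpha> A = 1 \<longleftrightarrow>
     (\<forall>\<epsilon>>0. \<forall>R. \<exists>r>R. (1 - \<epsilon>) * \<mu> (\<Delta>\<^sub>r r) < \<mu> (A \<inter> \<Delta>\<^sub>r r))"
  (is "_ \<longleftrightarrow> ?D")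
proof -
  let ?q = "\<lambda>r. \<mu> (A \<inter> \<Delta>\<^sub>r r) / \<mu> (\<Delta>\<^sub>r r)"
  \<comment> \<open>When \<open>\<mu> (\<Delta>\<^sub>r r)\<close> is 0, as for
    \<open>r \<le> 0\<close>, the quotient is 0 by convention. Since 1 bounds every quotient, the
    limsup is 1 as soon as it is not below 1.\<close>
  have "?q r \<le> 1" for r
    using measure_Int_sector_below_le[of A r] by (simp add: divide_le_eq_1 zero_less_measure_iff)
  then have le: "upper_density \<alpha> A \<le> 1"
    unfolding upper_density_def by (intro Limsup_bounded always_eventually) auto
  show ?thesis
  proof
    assume d: "upper_density \<alpha> A = 1"
    show ?D
    proof (intro allI impI, rule ccontr)
      fix \<epsilon> R :: real assume \<epsilon>: "\<epsilon> > 0" and n: "\<not> (\<exists>r>R. (1 - \<epsilon>) * \<mu> (\<Delta>\<^sub>r r) < \<mu> (A \<inter> \<Delta>\<^sub>r r))"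
      have "ereal (?q r) \<le> ereal (1 - \<epsilon>)" if "r > max R 0" for r
      proof -
        have "\<mu> (A \<inter> \<Delta>\<^sub>r r) \<le> (1 - \<epsilon>) * \<mu> (\<Delta>\<^sub>r r)" using n that by (metis max_less_iff_conj not_less)
        then show ?thesis using measure_sector_below_pos[of r] that by (simp add: pos_divide_le_eq)
      qed
      then have "upper_density \<alpha> A \<le> ereal (1 - \<epsilon>)"
        unfolding upper_density_def
        by (intro Limsup_bounded eventually_mono[OF eventually_gt_at_top[of "max R 0"]])
      with d \<epsilon> show False by (simp add: one_ereal_def)
    qed
  next
    assume D: ?D
    show "upper_density \<alpha> A = 1"
    proof (rule ccontr)
      assume "upper_density \<alpha> A \<noteq> 1"
      with le have "upper_density \<alpha> A < 1" by simp
      then obtain l where l: "upper_density \<alpha> A < ereal l" "ereal l < 1"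
        using ereal_dense2 by blast
      then have "\<forall>\<^sub>F r in at_top. ereal (?q r) < ereal l"
        unfolding upper_density_def by (intro Limsup_lessD)
      then obtain N where N: "\<And>r. r \<ge> N \<Longrightarrow> ?q r < l"
        by (auto simp: eventually_at_top_linorder)
      obtain r where r: "r > max N 0" "(1 - (1 - l)) * \<mu> (\<Delta>\<^sub>r r) < \<mu> (A \<inter> \<Delta>\<^sub>r r)"
        using D[rule_format, of "1 - l" "max N 0"] l by (auto simp: one_ereal_def)
      then show False using N[of r] measure_sector_below_pos[of r] by (auto simp: field_simps)
    qed
  qed
qed

lemma upper_density_empty: "upper_density \<alpha> {} \<noteq> 1"
  by (simp add: upper_density_def Limsup_const one_ereal_def)

text \<open>A loss that is eventually at most any given fraction of
  \<open>\<Delta>\<^sub>r r\<close> can be absorbed: half of \<open>\<epsilon>\<close> is spent on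
  the deficit of \<open>A\<close> and half on the passage to \<open>B\<close>.\<close>

lemma upper_density_eq_1_perturb:
  assumes A: "upper_density \<alpha> A = 1"
    and perturb: "\<And>\<epsilon>. \<epsilon> > 0 \<Longrightarrow> \<forall>\<^sub>F r in at_top. \<mu> (A \<inter> \<Delta>\<^sub>r r) - \<epsilon> * \<mu> (\<Delta>\<^sub>r r) \<le> \<mu> (B \<inter> \<Delta>\<^sub>r r)"
  shows "upper_density \<alpha> B = 1"
  unfolding upper_density_eq_1_iff
proof (intro allI impI)
  fix \<epsilon> R :: real assume "\<epsilon> > 0"
  then obtain N where N: "\<And>r. r \<ge> N \<Longrightarrow> \<mu> (A \<inter> \<Delta>\<^sub>r r) - \<epsilon>/2 * \<mu> (\<Delta>\<^sub>r r) \<le> \<mu> (B \<inter> \<Delta>\<^sub>r r)"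
    using perturb[of "\<epsilon>/2"] by (auto simp: eventually_at_top_linorder)
  obtain r where r: "r > max R N" "(1 - \<epsilon>/2) * \<mu> (\<Delta>\<^sub>r r) < \<mu> (A \<inter> \<Delta>\<^sub>r r)"
    using A \<open>\<epsilon> > 0\<close> unfolding upper_density_eq_1_iff by (meson half_gt_zero)
  have "(1 - \<epsilon>) * \<mu> (\<Delta>\<^sub>r r) < \<mu> (B \<inter> \<Delta>\<^sub>r r)"
    using N[of r] r by (auto simp: algebra_simps)
  with r show "\<exists>r>R. (1 - \<epsilon>) * \<mu> (\<Delta>\<^sub>r r) < \<mu> (B \<inter> \<Delta>\<^sub>r r)" by auto
qed

text \<open>The exceptional points have measure at most \<open>\<mu> (\<Delta>\<^sub>r R)\<close>, a
  constant, while \<open>\<mu> (\<Delta>\<^sub>r r)\<close> grows like the square of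
  \<open>r\<close>.\<close>

lemma upper_density_eq_1_almost_mono:
  assumes A: "upper_density \<alpha> A = 1" "A \<in> sets lebesgue" and B: "B \<in> sets lebesgue"
    and sub: "A \<inter> \<Delta> - B \<subseteq> ball 0 R"
  shows "upper_density \<alpha> B = 1"
proof (rule upper_density_eq_1_perturb[OF A(1)])
  fix \<epsilon> :: real assume \<epsilon>: "\<epsilon> > 0"
  have "filterlim (\<lambda>r. (\<epsilon> * \<mu> (\<Delta>\<^sub>r 1)) * r\<^sup>2) at_top at_top"
    using \<epsilon> measure_sector_below_pos[of 1] 
    by (intro filterlim_tendsto_pos_mult_at_top[OF tendsto_const] filterlim_pow_at_top filterlim_ident) auto
  then have "\<forall>\<^sub>F r in at_top. (\<epsilon> * \<mu> (\<Delta>\<^sub>r 1)) * r\<^sup>2 \<ge> \<mu> (\<Delta>\<^sub>r R)"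
    by (simp add: filterlim_at_top)
  then show "\<forall>\<^sub>F r in at_top. \<mu> (A \<inter> \<Delta>\<^sub>r r) - \<epsilon> * \<mu> (\<Delta>\<^sub>r r) \<le> \<mu> (B \<inter> \<Delta>\<^sub>r r)"
    using eventually_gt_at_top[of 0]
  proof eventually_elim
    case (elim r)
    have "\<mu> (A \<inter> \<Delta>\<^sub>r r) \<le> \<mu> ((B \<inter> \<Delta>\<^sub>r r) \<union> \<Delta>\<^sub>r R)"
      using sub A B lmeasurable_sector_below lmeasurable_Int_sector_below
      by (intro measure_mono_fmeasurable) (auto simp: sector_below_eq fmeasurableD fmeasurable.Un)
    also have "\<dots> \<le> \<mu> (B \<inter> \<Delta>\<^sub>r r) + \<mu> (\<Delta>\<^sub>r R)"
      using B lmeasurable_sector_below lmeasurable_Int_sector_below by (intro measure_Un_le) (auto simp: fmeasurableD)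
    also have "\<mu> (\<Delta>\<^sub>r R) \<le> \<epsilon> * \<mu> (\<Delta>\<^sub>r r)"
      using elim measure_sector_below[of r] by (simp add: mult_ac)
    finally show ?case by simp
  qed
qed

text \<open>
  By convexity, \<open>(1 - \<epsilon>) \<Delta>\<^sub>r + \<epsilon> r/2\<close> is contained in both \<open>\<Delta>\<^sub>r\<close> and \<open>\<Delta>\<^sub>r + s\<close> once \<open>r\<close> is large, and it
  fills the fraction \<open>(1 - \<epsilon>)\<^sup>2\<close> of \<open>\<Delta>\<^sub>r\<close>.
\<close>

lemma upper_density_translate:
  assumes B: "upper_density \<alpha> B = 1" "B \<in> sets lebesgue" and s: "s \<in> \<Delta>"
    and C: "C \<in> sets lebesgue" "\<And>t. t \<in> \<Delta> \<Longrightarrow> t + s \<in> B \<Longrightarrow> t \<in> C"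
  shows "upper_density \<alpha> C = 1"
proof (rule upper_density_eq_1_perturb[OF B(1)])
  fix \<epsilon>' :: real assume \<epsilon>': "\<epsilon>' > 0"
  \<comment> \<open>The part of \<open>\<Delta>\<^sub>r r\<close> to be lost is the fraction
    \<open>2 * \<epsilon> - \<epsilon>\<^sup>2\<close>, which this choice keeps below
    \<open>\<epsilon>'\<close>.\<close>
  define \<epsilon> where "\<epsilon> = min (\<epsilon>'/2) (1/2)"
  have \<epsilon>: "0 < \<epsilon>" "\<epsilon> \<le> \<epsilon>'/2" "\<epsilon> < 1" using \<epsilon>' by (auto simp: \<epsilon>_def)
  let ?t = "tan \<alpha>"
  \<comment> \<open>The two conditions say that the point \<open>q\<close> below has norm less than
    \<open>r\<close> and lies in the sector.\<close>
  have "\<forall>\<^sub>F r in at_top. norm s / \<epsilon> < r / 2 \<and> \<bar>Im s / \<epsilon>\<bar> \<le> ?t * (r / 2 - Re s / \<epsilon>)"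
  proof (rule eventually_mono[OF eventually_conj[OF eventually_gt_at_top eventually_ge_at_top]])
    fix r assume r: "2 * (norm s / \<epsilon>) < r \<and> 2 * (\<bar>Im s / \<epsilon>\<bar> / ?t + Re s / \<epsilon>) \<le> r"
    have "a \<le> r / 2 - b" if "2 * (a + b) \<le> r" for a b :: real using that by simp
    from this[OF conjunct2[OF r]] have "\<bar>Im s / \<epsilon>\<bar> / ?t \<le> r / 2 - Re s / \<epsilon>" .
    then have "\<bar>Im s / \<epsilon>\<bar> \<le> (r / 2 - Re s / \<epsilon>) * ?t"
      using tan_alpha_pos by (simp only: pos_divide_le_eq)
    with r show "norm s / \<epsilon> < r / 2 \<and> \<bar>Im s / \<epsilon>\<bar> \<le> ?t * (r / 2 - Re s / \<epsilon>)"
      by (simp add: mult.commute)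
  qed
  then show "\<forall>\<^sub>F r in at_top. \<mu> (B \<inter> \<Delta>\<^sub>r r) - \<epsilon>' * \<mu> (\<Delta>\<^sub>r r) \<le> \<mu> (C \<inter> \<Delta>\<^sub>r r)"
    using eventually_gt_at_top[of 0]
  proof eventually_elim
    case (elim r)
    \<comment> \<open>Subtracting \<open>s\<close> from a point of \<open>?E\<close> replaces
      \<open>r/2\<close> by \<open>q\<close> in the convex combination, so both the point and its
      translate are convex combinations inside \<open>\<Delta>\<^sub>r r\<close>.\<close>
    define q where "q = of_real (r/2) - (1/\<epsilon>) *\<^sub>R s"
    have q: "q \<in> \<Delta>" using elim by (auto simp: q_def mem_sector_iff)
    have nq: "norm q < r"
    proof -
      have "norm q \<le> r/2 + norm s / \<epsilon>"
        unfolding q_def using norm_triangle_ineq4[of "of_real (r/2)" "(1/\<epsilon>) *\<^sub>R s"] elim \<epsilon> by simp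
      with elim show ?thesis by linarith
    qed
    let ?E = "(\<lambda>t. (1-\<epsilon>) *\<^sub>R t + of_real (\<epsilon> * r/2)) ` \<Delta>\<^sub>r r"
    have E: "?E \<in> lmeasurable" "\<mu> ?E = (1-\<epsilon>)\<^sup>2 * \<mu> (\<Delta>\<^sub>r r)"
      using sector_below_affine_image[of "1-\<epsilon>" "of_real (\<epsilon> * r/2)" r] \<epsilon> by auto
    have sE: "x \<in> \<Delta>\<^sub>r r" "x - s \<in> \<Delta>\<^sub>r r" if xE: "x \<in> ?E" for x
    proof -
      obtain t where t: "t \<in> \<Delta>\<^sub>r r" and x: "x = (1-\<epsilon>) *\<^sub>R t + of_real (\<epsilon> * r/2)" using xE by blast
      have cv: "(1-\<epsilon>) *\<^sub>R t + \<epsilon> *\<^sub>R p \<in> \<Delta>\<^sub>r r" if "p \<in> \<Delta>" "norm p < r" for p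
      proof -
        have "norm ((1-\<epsilon>) *\<^sub>R t + \<epsilon> *\<^sub>R p) \<le> (1-\<epsilon>) * norm t + \<epsilon> * norm p"
          using norm_triangle_ineq[of "(1-\<epsilon>) *\<^sub>R t" "\<epsilon> *\<^sub>R p"] \<epsilon> by simp
        also have "\<dots> < r" using that t \<epsilon> by (intro convex_bound_lt) (auto simp: sector_below_def)
        finally show ?thesis using t that \<epsilon> by (auto simp: sector_below_def intro!: sector_add sector_scale)
      qed
      have "x = (1-\<epsilon>) *\<^sub>R t + \<epsilon> *\<^sub>R of_real (r/2)" by (simp add: x scaleR_conv_of_real)
      then show "x \<in> \<Delta>\<^sub>r r" using cv[of "of_real (r/2)"] elim of_real_in_sector[of "r/2"] by simp
      have "x - s = (1-\<epsilon>) *\<^sub>R t + \<epsilon> *\<^sub>R q"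
        using \<epsilon> by (simp add: x q_def scaleR_conv_of_real algebra_simps)
      then show "x - s \<in> \<Delta>\<^sub>r r" using cv[OF q nq] by simp
    qed
    have ms: "B \<inter> ?E \<in> lmeasurable" using E B by (metis fmeasurable_Int_fmeasurable inf_commute)
    have "\<mu> (B \<inter> \<Delta>\<^sub>r r) \<le> \<mu> ((B \<inter> ?E) \<union> (\<Delta>\<^sub>r r - ?E))"
      using B E(1) ms lmeasurable_sector_below lmeasurable_Int_sector_below
      by (intro measure_mono_fmeasurable) (auto simp: fmeasurableD fmeasurable.Un fmeasurable.Diff)
    also have "\<dots> \<le> \<mu> (B \<inter> ?E) + \<mu> (\<Delta>\<^sub>r r - ?E)"
      using B ms E lmeasurable_sector_below by (intro measure_Un_le) (auto simp: fmeasurableD)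
    also have "\<mu> (\<Delta>\<^sub>r r - ?E) = \<mu> (\<Delta>\<^sub>r r) - \<mu> ?E"
      using E sE(1) lmeasurable_sector_below by (intro measurable_measure_Diff) (auto simp: fmeasurableD)
    also have "\<dots> \<le> \<epsilon>' * \<mu> (\<Delta>\<^sub>r r)"
    proof -
      have "1 - (1-\<epsilon>)\<^sup>2 = 2 * \<epsilon> - \<epsilon>\<^sup>2" by (simp add: power2_eq_square algebra_simps)
      then have "1 - (1-\<epsilon>)\<^sup>2 \<le> \<epsilon>'" using \<epsilon> zero_le_power2[of \<epsilon>] by linarith
      then have "(1 - (1-\<epsilon>)\<^sup>2) * \<mu> (\<Delta>\<^sub>r r) \<le> \<epsilon>' * \<mu> (\<Delta>\<^sub>r r)" by (intro mult_right_mono) auto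
      then show ?thesis unfolding E(2) left_diff_distrib by simp
    qed
    also have "\<mu> (B \<inter> ?E) = \<mu> ((\<lambda>x. x - s) ` (B \<inter> ?E))"
      by (simp only: measure_translation_subtract)
    also have "\<dots> \<le> \<mu> (C \<inter> \<Delta>\<^sub>r r)"
    proof (intro measure_mono_fmeasurable lmeasurable_Int_sector_below C)
      show "(\<lambda>x. x - s) ` (B \<inter> ?E) \<in> sets lebesgue"
        using measurable_translation_subtract[OF ms] by blast
      show "(\<lambda>x. x - s) ` (B \<inter> ?E) \<subseteq> C \<inter> \<Delta>\<^sub>r r"
        using sE(2) C(2) by (fastforce simp: sector_below_def)
    qed
    finally show ?case by simp
  qed
qed

text \<open>Pick increasing radii such that \<open>F n\<close> nearly fills the truncated sector of
  radius \<open>R (Suc n)\<close>, and let \<open>A\<close> demand membership in \<open>F n\<close>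
  only outside the ball of radius \<open>R n\<close>. Up to \<open>R (Suc n)\<close> only the
  conditions with index at most \<open>n\<close> are active, and \<open>F n\<close> implies them all
  because \<open>F\<close> decreases.\<close>

lemma upper_density_diagonal:
  assumes F: "\<And>n. F n \<in> sets lebesgue" "\<And>n. upper_density \<alpha> (F n) = 1" "decseq F"
  obtains A where "A \<in> sets lebesgue" "A \<subseteq> \<Delta>" "upper_density \<alpha> A = 1"
    "\<And>n. \<exists>R. A - F n \<subseteq> ball 0 R"
proof -
  \<comment> \<open>The clause \<open>real n < R n\<close> makes the radii tend to infinity.\<close>
  have "\<exists>R. \<forall>n. real n < R n \<and> (R n < R (Suc n) \<and>
      (1 - 1 / Suc n) * \<mu> (\<Delta>\<^sub>r (R (Suc n))) < \<mu> (F n \<inter> \<Delta>\<^sub>r (R (Suc n))))"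
  proof (rule dependent_nat_choice)
    show "\<exists>x::real. real 0 < x" by (rule exI[of _ 1]) simp
    fix x :: real and n :: nat
    obtain y where "y > max x (Suc n)" "(1 - 1 / Suc n) * \<mu> (\<Delta>\<^sub>r y) < \<mu> (F n \<inter> \<Delta>\<^sub>r y)"
      using F(2)[of n, unfolded upper_density_eq_1_iff, rule_format, of "1 / Suc n" "max x (Suc n)"] by auto
    then show "\<exists>y. real (Suc n) < y \<and> x < y \<and> (1 - 1 / Suc n) * \<mu> (\<Delta>\<^sub>r y) < \<mu> (F n \<inter> \<Delta>\<^sub>r y)"
      by auto
  qed
  then obtain R where R: "\<And>n::nat. real n < R n" "\<And>n. R n < R (Suc n)"
      "\<And>n. (1 - 1 / Suc n) * \<mu> (\<Delta>\<^sub>r (R (Suc n))) < \<mu> (F n \<inter> \<Delta>\<^sub>r (R (Suc n)))"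
    by blast
  have incR: "R m \<le> R n" if "m \<le> n" for m n
    using lift_Suc_mono_le[of R, OF less_imp_le[OF R(2)] that] .
  define A where "A = \<Delta> \<inter> (\<Inter>n. ball 0 (R n) \<union> F n)"
  have mA: "A \<in> sets lebesgue"
    unfolding A_def using F(1) closed_sector by (intro sets.Int sets.countable_INT sets.Un) auto
  have sub: "F n \<inter> \<Delta>\<^sub>r (R (Suc n)) \<subseteq> A \<inter> \<Delta>\<^sub>r (R (Suc n))" for n
  proof -
    have "norm t < R m \<or> t \<in> F m" if "t \<in> F n" "norm t < R (Suc n)" for t m
    proof (cases "m \<le> n")
      case True
      then show ?thesis using F(3) that by (auto simp: decseq_def)
    next
      case False
      then show ?thesis using that incR[of "Suc n" m] by auto
    qed
    then have "t \<in> A" if "t \<in> F n" "t \<in> \<Delta>\<^sub>r (R (Suc n))" for t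
      using that unfolding A_def sector_below_eq by simp
    then show ?thesis by blast
  qed
  have "upper_density \<alpha> A = 1"
    unfolding upper_density_eq_1_iff
  proof (intro allI impI)
    fix \<epsilon> Q :: real assume "\<epsilon> > 0"
    obtain n :: nat where n: "n > max Q (1/\<epsilon>)" using reals_Archimedean2 by blast
    have "1 < real n * \<epsilon>" using n \<open>\<epsilon> > 0\<close> by (simp add: field_simps)
    then have "1 / Suc n \<le> \<epsilon>" using \<open>\<epsilon> > 0\<close> by (simp add: field_simps)
    then have "(1 - \<epsilon>) * \<mu> (\<Delta>\<^sub>r (R (Suc n))) \<le> (1 - 1 / Suc n) * \<mu> (\<Delta>\<^sub>r (R (Suc n)))"
      by (intro mult_right_mono) auto
    also have "\<dots> < \<mu> (F n \<inter> \<Delta>\<^sub>r (R (Suc n)))" by (rule R(3))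
    also have "\<dots> \<le> \<mu> (A \<inter> \<Delta>\<^sub>r (R (Suc n)))"
      using sub F(1) mA lmeasurable_Int_sector_below by (intro measure_mono_fmeasurable) (auto simp: fmeasurableD)
    finally show "\<exists>r>Q. (1 - \<epsilon>) * \<mu> (\<Delta>\<^sub>r r) < \<mu> (A \<inter> \<Delta>\<^sub>r r)"
      using n R(1)[of "Suc n"] by (intro exI[of _ "R (Suc n)"]) auto
  qed
  moreover have "A - F n \<subseteq> ball 0 (R n)" for n by (auto simp: A_def)
  ultimately show ?thesis using that[of A] mA by (auto simp: A_def)
qed

end

section \<open>Uniform boundedness and closures of subspaces\<close>

text \<open>Pointwise boundedness covers the space by the closed sets \<open>E n\<close>, so by
  Baire one of them contains a ball. Differences of points of that ball bound all \<open>F i\<close>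
  near 0, and scaling extends the bound.\<close>

lemma uniform_boundedness:
  fixes F :: "'i \<Rightarrow> 'a::banach \<Rightarrow> 'b::real_normed_vector"
  assumes lin: "\<And>i. i \<in> I \<Longrightarrow> linear (F i)" and cont: "\<And>i. i \<in> I \<Longrightarrow> continuous_on UNIV (F i)"
    and bdd: "\<And>x. bounded ((\<lambda>i. F i x) ` I)"
  obtains M where "M > 0" "\<And>i x. i \<in> I \<Longrightarrow> norm (F i x) \<le> M * norm x"
proof -
  define E where "E n = (\<Inter>i\<in>I. {x. norm (F i x) \<le> real n})" for n
  have clE: "closed (E n)" for n
    unfolding E_def using cont by (intro closed_INT ballI closed_Collect_le continuous_intros) auto
  have "x \<in> \<Union>(range E)" for x
  proof -
    obtain b where b: "\<And>i. i \<in> I \<Longrightarrow> norm (F i x) \<le> b"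
      using bdd[of x] by (auto simp: bounded_iff)
    obtain n where "b \<le> real n" using real_arch_simple by blast
    then have "x \<in> E n" unfolding E_def using b order_trans by blast
    then show ?thesis by blast
  qed
  then have UN: "\<Union>(range E) = UNIV" by blast
  obtain n where "interior (E n) \<noteq> {}"
    using Baire_category_alt[of "euclidean :: 'a topology" "range E"]
      completely_metrizable_space_euclidean clE UN by (auto simp: interior_of_eq)
  then obtain a e where e: "e > 0" "ball a e \<subseteq> E n"
    by (metis ex_in_conv mem_interior)
  have aE: "a \<in> E n" using e by auto
  have small: "norm (F i x) \<le> 2 * n" if "i \<in> I" "norm x < e" for i x
  proof -
    have "a + x \<in> E n" using e that by (auto simp: dist_norm)
    then have "norm (F i (a + x)) \<le> n" "norm (F i a) \<le> n" using aE that by (auto simp: E_def)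
    moreover have "F i x = F i (a + x) - F i a" using lin[OF that(1)] by (simp add: linear_add)
    ultimately show ?thesis using norm_triangle_ineq4[of "F i (a + x)" "F i a"] by simp
  qed
  \<comment> \<open>The summand 1 keeps the constant positive when \<open>n = 0\<close>.\<close>
  have "norm (F i x) \<le> (4 * n / e + 1) * norm x" if i: "i \<in> I" for i x
  proof (cases "x = 0")
    case True
    then show ?thesis using lin[OF i] by (simp add: linear_0)
  next
    case False
    define c where "c = e / (2 * norm x)"
    have c: "c > 0" using False e by (simp add: c_def)
    have "norm (F i (c *\<^sub>R x)) \<le> 2 * n" using False e by (intro small i) (simp add: c_def)
    then have "c * norm (F i x) \<le> 2 * n" using lin[OF i] c by (simp add: linear_scale)
    then have "norm (F i x) \<le> 4 * n / e * norm x"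
      using False e by (simp add: c_def field_simps)
    then show ?thesis by (simp add: distrib_right add_increasing2)
  qed
  moreover have "4 * n / e + 1 > 0" using e by (simp add: add_nonneg_pos)
  ultimately show ?thesis using that by blast
qed

lemma (in banach_over) subspace_closure:
  assumes "subspace S"
  shows "subspace (closure S)"
proof (rule subspaceI)
  show "0 \<in> closure S" using subspace_0[OF assms] closure_subset by blast
  show "x + y \<in> closure S" if xy: "x \<in> closure S" "y \<in> closure S" for x y
  proof -
    obtain f g where "\<And>n. f n \<in> S" "f \<longlonglongrightarrow> x" "\<And>n. g n \<in> S" "g \<longlonglongrightarrow> y"
      using xy unfolding closure_sequential by blast
    then show ?thesis unfolding closure_sequential
      using subspace_add[OF assms] by (intro exI[of _ "\<lambda>n. f n + g n"]) (auto intro: tendsto_add)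
  qed
  show "smul c x \<in> closure S" if x: "x \<in> closure S" for c x
  proof -
    obtain f where f: "\<And>n. f n \<in> S" "f \<longlonglongrightarrow> x" using x unfolding closure_sequential by blast
    \<comment> \<open>Continuity of \<open>smul c\<close> is extracted from
      \<open>norm_scale\<close>.\<close>
    have "(\<lambda>n. norm c * norm (f n - x)) \<longlonglongrightarrow> norm c * 0"
      using f(2) by (intro tendsto_mult tendsto_const) (simp add: LIM_zero_iff tendsto_norm_zero)
    then have "(\<lambda>n. norm (smul c (f n - x))) \<longlonglongrightarrow> 0" by (simp add: norm_scale)
    then have "(\<lambda>n. smul c (f n) - smul c x) \<longlonglongrightarrow> 0"
      unfolding scale_right_diff_distrib by (rule tendsto_norm_zero_cancel)
    then have "(\<lambda>n. smul c (f n)) \<longlonglongrightarrow> smul c x" by (rule LIM_zero_cancel)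
    then show ?thesis unfolding closure_sequential
      using subspace_scale[OF assms f(1)] by (intro exI[of _ "\<lambda>n. smul c (f n)"]) blast
  qed
qed

lemma eventually_at_infinity_in:
  "eventually P (at_infinity_in A) \<longleftrightarrow> (\<exists>R. \<forall>t\<in>A. R \<le> norm t \<longrightarrow> P t)"
  by (auto simp: at_infinity_in_def eventually_inf_principal eventually_at_infinity)

section \<open>Orbits and their sets of small and large times\<close>

locale C0_sector_semigroup = complex_sector \<alpha> + banach_over smul
  for \<alpha> :: real and smul :: "'k::real_normed_field \<Rightarrow> 'a::banach \<Rightarrow> 'a" +
  fixes T :: "complex \<Rightarrow> 'a \<Rightarrow> 'a"
  assumes C0: "C0_semigroup smul \<alpha> T"
begin

text \<open>Through \<open>scale_of_real\<close>, linearity over \<open>'k\<close> yields real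
  linearity, the form used in the norm estimates; \<open>T_smul\<close> keeps the full field for
  statements about subspaces.\<close>

lemma linear_T: "t \<in> \<Delta> \<Longrightarrow> linear (T t)"
proof -
  assume "t \<in> \<Delta>"
  then interpret L: Vector_Spaces.linear smul smul "T t" using C0 by (simp add: C0_semigroup_def)
  show ?thesis
    by (intro linearI) (simp_all add: L.add L.scale flip: scale_of_real)
qed

lemma T_smul: "t \<in> \<Delta> \<Longrightarrow> T t (smul c x) = smul c (T t x)"
proof -
  assume "t \<in> \<Delta>"
  then interpret L: Vector_Spaces.linear smul smul "T t" using C0 by (simp add: C0_semigroup_def)
  show ?thesis by (rule L.scale)
qed

lemma continuous_T: "t \<in> \<Delta> \<Longrightarrow> continuous_on UNIV (T t)"
  using C0 by (simp add: C0_semigroup_def)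

lemma T_add: "s \<in> \<Delta> \<Longrightarrow> t \<in> \<Delta> \<Longrightarrow> T (s + t) x = T s (T t x)"
  using C0 by (metis C0_semigroup_def comp_apply)

lemma T_commute: "s \<in> \<Delta> \<Longrightarrow> t \<in> \<Delta> \<Longrightarrow> T s (T t x) = T t (T s x)"
  by (metis T_add add.commute)

lemma continuous_orbit: "continuous_on \<Delta> (\<lambda>t. T t x)"
  using C0 by (simp add: C0_semigroup_def continuous_on)

text \<open>Orbits are continuous, hence bounded over the compact set
  \<open>\<Delta> \<inter> cball 0 r\<close>; uniform boundedness gives one constant for all
  vectors.\<close>

lemma T_bounded_on_bounded:
  obtains M where "M > 0" "\<And>t x. t \<in> \<Delta> \<Longrightarrow> norm t \<le> r \<Longrightarrow> norm (T t x) \<le> M * norm x"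
proof -
  have "bounded ((\<lambda>t. T t x) ` (\<Delta> \<inter> cball 0 r))" for x
    using closed_sector continuous_orbit
    by (intro compact_imp_bounded compact_continuous_image)
       (auto intro: continuous_on_subset closed_Int_compact)
  then obtain M where "M > 0" "\<And>t x. t \<in> \<Delta> \<inter> cball 0 r \<Longrightarrow> norm (T t x) \<le> M * norm x"
    using uniform_boundedness[of "\<Delta> \<inter> cball 0 r" T] linear_T continuous_T by blast
  then show ?thesis using that by auto
qed

text \<open>The sign \<open>\<sigma> = \<plusminus>1\<close> serves both the times of small and the times of large orbit norm.\<close>

definition orbit_times :: "real \<Rightarrow> real \<Rightarrow> 'a \<Rightarrow> complex set" where
  "orbit_times \<sigma> c y = {t \<in> \<Delta>. \<sigma> * norm (T t y) < c}"

abbreviation small_times :: "real \<Rightarrow> 'a \<Rightarrow> complex set" where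
  "small_times c y \<equiv> orbit_times 1 c y"

abbreviation large_times :: "real \<Rightarrow> 'a \<Rightarrow> complex set" where
  "large_times c y \<equiv> orbit_times (-1) (-c) y"

lemma mem_orbit_times: "t \<in> orbit_times \<sigma> c y \<longleftrightarrow> t \<in> \<Delta> \<and> \<sigma> * norm (T t y) < c"
  by (simp add: orbit_times_def)

lemma sets_orbit_times: "orbit_times \<sigma> c y \<in> sets lebesgue"
proof -
  have "closed (\<Delta> \<inter> (\<lambda>t. \<sigma> * norm (T t y)) -` {c..})"
    by (intro continuous_closed_preimage continuous_intros continuous_orbit closed_sector)
  moreover have "orbit_times \<sigma> c y = \<Delta> - (\<Delta> \<inter> (\<lambda>t. \<sigma> * norm (T t y)) -` {c..})"
    by (auto simp: mem_orbit_times)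
  ultimately show ?thesis using closed_sector by auto
qed

text \<open>By continuity of measure from below, tightening the threshold by a small
  \<open>1 / Suc n\<close> keeps the measure above \<open>a\<close>. The operators are uniformly
  bounded up to radius \<open>r\<close>, so nearby vectors have orbits within
  \<open>1 / Suc n\<close> there and satisfy the original threshold at the same times.\<close>

lemma open_orbit_times_measure_greater:
  assumes \<sigma>: "\<bar>\<sigma>\<bar> = 1"
  shows "open {y. a < \<mu> (orbit_times \<sigma> c y \<inter> \<Delta>\<^sub>r r)}"
proof (rule openI, unfold mem_Collect_eq)
  fix y assume a: "a < \<mu> (orbit_times \<sigma> c y \<inter> \<Delta>\<^sub>r r)"
  let ?F = "\<lambda>n. orbit_times \<sigma> (c - 1 / Suc n) y \<inter> \<Delta>\<^sub>r r"
  have "incseq ?F"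
  proof (rule incseq_SucI)
    fix n
    have "1 / real (Suc (Suc n)) \<le> 1 / real (Suc n)" by (simp add: field_simps)
    then show "?F n \<subseteq> ?F (Suc n)" by (auto simp: mem_orbit_times)
  qed
  moreover have "(\<Union>n. ?F n) = orbit_times \<sigma> c y \<inter> \<Delta>\<^sub>r r"
  proof -
    have "\<exists>n. \<sigma> * norm (T t y) < c - 1 / Suc n" if "\<sigma> * norm (T t y) < c" for t
      using that nat_approx_posE[of "c - \<sigma> * norm (T t y)"] by (metis diff_gt_0_iff_gt less_diff_eq add.commute)
    moreover have "u < c" if "u < c - 1 / Suc n" for u n
    proof -
      have "1 / real (Suc n) > 0" by simp
      with that show ?thesis by linarith
    qed
    ultimately show ?thesis by (auto simp: mem_orbit_times)
  qed
  moreover have "range ?F \<subseteq> sets lebesgue"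
    using lmeasurable_Int_sector_below[OF sets_orbit_times] by (blast dest: fmeasurableD)
  ultimately have "(\<lambda>n. \<mu> (?F n)) \<longlonglongrightarrow> \<mu> (orbit_times \<sigma> c y \<inter> \<Delta>\<^sub>r r)"
    using Lim_measure_incseq[of ?F lebesgue] fmeasurableD2[OF lmeasurable_Int_sector_below[OF sets_orbit_times]]
    by (simp only: infinity_ennreal_def not_False_eq_True simp_thms)
  then have "\<forall>\<^sub>F n in sequentially. a < \<mu> (?F n)"
    using a by (simp add: order_tendsto_iff)
  then obtain n where n: "a < \<mu> (?F n)" by (auto simp: eventually_sequentially)
  obtain M where M: "M > 0" "\<And>t x. t \<in> \<Delta> \<Longrightarrow> norm t \<le> r \<Longrightarrow> norm (T t x) \<le> M * norm x"
    using T_bounded_on_bounded by blast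
  have "a < \<mu> (orbit_times \<sigma> c y' \<inter> \<Delta>\<^sub>r r)" if y': "y' \<in> ball y (1 / (M * Suc n))" for y'
  proof -
    have "?F n \<subseteq> orbit_times \<sigma> c y' \<inter> \<Delta>\<^sub>r r"
    proof
      fix t assume t: "t \<in> ?F n"
      then have t': "t \<in> \<Delta>" "norm t \<le> r" by (auto simp: sector_below_def)
      have "norm (T t y' - T t y) = norm (T t (y' - y))" using t' by (simp add: linear_T linear_diff)
      also have "\<dots> \<le> M * norm (y' - y)" using M t' by blast
      also have "\<dots> < M * (1 / (M * Suc n))"
        using y' M(1)
        by (intro mult_strict_left_mono) (simp_all add: dist_norm norm_minus_commute del: of_nat_Suc)
      also have "\<dots> = 1 / Suc n" using M(1) by simp
      finally have "norm (T t y' - T t y) < 1 / Suc n" .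
      then have "\<bar>norm (T t y') - norm (T t y)\<bar> < 1 / Suc n"
        using norm_triangle_ineq3[of "T t y'" "T t y"] by linarith
      moreover have "\<sigma> = 1 \<or> \<sigma> = -1" using \<sigma> by linarith
      ultimately have "\<sigma> * norm (T t y') < \<sigma> * norm (T t y) + 1 / Suc n" by auto
      then show "t \<in> orbit_times \<sigma> c y' \<inter> \<Delta>\<^sub>r r" using t by (auto simp: mem_orbit_times)
    qed
    then have "\<mu> (?F n) \<le> \<mu> (orbit_times \<sigma> c y' \<inter> \<Delta>\<^sub>r r)"
      using lmeasurable_Int_sector_below[OF sets_orbit_times]
      by (intro measure_mono_fmeasurable) (auto simp: fmeasurableD)
    with n show ?thesis by simp
  qed
  moreover have "1 / (M * Suc n) > 0" using M by simp
  ultimately show "\<exists>e>0. ball y e \<subseteq> {y. a < \<mu> (orbit_times \<sigma> c y \<inter> \<Delta>\<^sub>r r)}" by blast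
qed

section \<open>Chaotic vectors, chaotic pairs and irregular vectors\<close>

definition chaotic_vector :: "'a \<Rightarrow> bool" where
  "chaotic_vector x \<longleftrightarrow> (\<exists>\<delta>>0. (\<forall>\<epsilon>>0. upper_density \<alpha> (small_times \<epsilon> x) = 1) \<and>
     upper_density \<alpha> (large_times \<delta> x) = 1)"

lemma dist_chaotic_pair_iff: "dist_chaotic_pair \<alpha> T x y \<longleftrightarrow> chaotic_vector (x - y)"
proof -
  have "{t \<in> \<Delta>. norm (T t x - T t y) < c} = small_times c (x - y)"
       "{t \<in> \<Delta>. norm (T t x - T t y) > c} = large_times c (x - y)" for c
    using linear_T by (auto simp: mem_orbit_times linear_diff)
  then show ?thesis by (simp add: dist_chaotic_pair_def chaotic_vector_def)
qed

lemma chaotic_vector_scaleR: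
  assumes x: "chaotic_vector x" and c: "c \<noteq> 0"
  shows "chaotic_vector (c *\<^sub>R x)"
proof -
  obtain \<delta> where \<delta>: "\<delta> > 0" "\<And>\<epsilon>. \<epsilon> > 0 \<Longrightarrow> upper_density \<alpha> (small_times \<epsilon> x) = 1"
    "upper_density \<alpha> (large_times \<delta> x) = 1" using x by (auto simp: chaotic_vector_def)
  have *: "small_times b (c *\<^sub>R x) = small_times (b / \<bar>c\<bar>) x"
     "large_times b (c *\<^sub>R x) = large_times (b / \<bar>c\<bar>) x" for b
    using c linear_T by (auto simp: mem_orbit_times linear_scale field_simps)
  show ?thesis
    unfolding chaotic_vector_def * using \<delta> c by (intro exI[of _ "\<bar>c\<bar> * \<delta>"]) auto
qed

text \<open>An uncountable set has two distinct points, whose difference is chaotic. Conversely,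
  distinct points of the real line through \<open>x\<close> differ by a nonzero multiple of
  \<open>x\<close>.\<close>

lemma dist_chaotic_iff: "dist_chaotic \<alpha> T \<longleftrightarrow> (\<exists>x. chaotic_vector x)"
proof
  assume "dist_chaotic \<alpha> T"
  then obtain K where K: "uncountable K" "\<And>x y. x \<in> K \<Longrightarrow> y \<in> K \<Longrightarrow> x \<noteq> y \<Longrightarrow> chaotic_vector (x - y)"
    by (auto simp: dist_chaotic_def dist_chaotic_pair_iff)
  then show "\<exists>x. chaotic_vector x"
    by (metis countable_empty countable_insert equals0I insertCI subset_singletonD subsetI countable_subset)
next
  assume "\<exists>x. chaotic_vector x"
  then obtain x where x: "chaotic_vector x" ..
  \<comment> \<open>This makes the multiples of \<open>x\<close> pairwise distinct, hence
    uncountably many.\<close>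
  have "x \<noteq> 0"
  proof
    assume "x = 0"
    then have "large_times \<delta> x = {}" if "\<delta> > 0" for \<delta>
      using that linear_T by (auto simp: mem_orbit_times linear_0)
    with x show False by (auto simp: chaotic_vector_def upper_density_empty)
  qed
  then have "inj (\<lambda>c. c *\<^sub>R x)" by (auto simp: inj_on_def)
  then have "uncountable (range (\<lambda>c. c *\<^sub>R x))"
    using countable_image_inj_on uncountable_UNIV_real by blast
  moreover have "dist_chaotic_pair \<alpha> T u v"
    if "u \<in> range (\<lambda>c. c *\<^sub>R x)" "v \<in> range (\<lambda>c. c *\<^sub>R x)" "u \<noteq> v" for u v
    using that x chaotic_vector_scaleR by (force simp: dist_chaotic_pair_iff simp flip: scaleR_diff_left)
  ultimately show "dist_chaotic \<alpha> T" unfolding dist_chaotic_def by blast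
qed

lemma upper_density_orbit_times:
  assumes "A \<in> sets lebesgue" "A \<subseteq> \<Delta>" "upper_density \<alpha> A = 1"
    and ev: "\<forall>\<^sub>F t in at_infinity_in A. \<sigma> * norm (T t x) < c"
  shows "upper_density \<alpha> (orbit_times \<sigma> c x) = 1"
proof -
  obtain R where R: "\<And>t. t \<in> A \<Longrightarrow> R \<le> norm t \<Longrightarrow> \<sigma> * norm (T t x) < c"
    using ev by (auto simp: eventually_at_infinity_in)
  have "A \<inter> \<Delta> - orbit_times \<sigma> c x \<subseteq> ball 0 R"
    using R by (force simp: mem_orbit_times)
  then show ?thesis by (rule upper_density_eq_1_almost_mono[OF assms(3,1) sets_orbit_times])
qed

lemma dist_semi_irregular_imp_chaotic_vector:
  assumes "dist_semi_irregular \<alpha> T x"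
  shows "chaotic_vector x"
proof -
  obtain A B where A: "A \<in> sets lebesgue" "A \<subseteq> \<Delta>" "upper_density \<alpha> A = 1"
    and B: "B \<in> sets lebesgue" "B \<subseteq> \<Delta>" "upper_density \<alpha> B = 1"
    and limA: "((\<lambda>t. norm (T t x)) \<longlongrightarrow> 0) (at_infinity_in A)"
    and limB: "Liminf (at_infinity_in B) (\<lambda>t. ereal (norm (T t x))) > 0"
    using assms by (auto simp: dist_semi_irregular_def)
  \<comment> \<open>A real number lies strictly between 0 and the liminf even if the latter is
    infinite.\<close>
  obtain \<delta> where \<delta>: "0 < ereal \<delta>" "ereal \<delta> < Liminf (at_infinity_in B) (\<lambda>t. ereal (norm (T t x)))"
    using ereal_dense2[OF limB] by blast
  have "upper_density \<alpha> (large_times \<delta> x) = 1"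
    using less_LiminfD[OF \<delta>(2)] by (intro upper_density_orbit_times[OF B]) simp
  moreover have "upper_density \<alpha> (small_times \<epsilon> x) = 1" if "\<epsilon> > 0" for \<epsilon>
    using order_tendstoD(2)[OF limA that] by (intro upper_density_orbit_times[OF A]) simp
  ultimately show ?thesis using \<delta>(1) by (auto simp: chaotic_vector_def)
qed

lemma dist_irregular_imp_dist_semi_irregular:
  assumes "dist_irregular \<alpha> T x"
  shows "dist_semi_irregular \<alpha> T x"
proof -
  have "0 < Liminf F (\<lambda>t. ereal (norm (T t x)))"
    if "filterlim (\<lambda>t. norm (T t x)) at_top F" for F
  proof -
    have "\<forall>\<^sub>F t in F. ereal 1 \<le> ereal (norm (T t x))"
      using that by (simp add: filterlim_at_top)
    from Liminf_bounded[OF this] show ?thesis by (meson less_le_trans ereal_less(2) zero_less_one)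
  qed
  with assms show ?thesis unfolding dist_irregular_def dist_semi_irregular_def by blast
qed

text \<open>Both families of time sets decrease with \<open>n\<close>, so diagonalisation yields
  single sets \<open>A\<close> and \<open>B\<close> that lie in every member up to a bounded part;
  these witness the two limits.\<close>

lemma dist_irregularI:
  assumes small: "\<And>n. upper_density \<alpha> (small_times (1 / Suc n) x) = 1"
    and large: "\<And>n. upper_density \<alpha> (large_times (real n) x) = 1"
  shows "dist_irregular \<alpha> T x"
proof -
  have "1 / real (Suc n) \<le> 1 / real (Suc m)" if "m \<le> n" for m n
    using that by (simp add: field_simps)
  then have "decseq (\<lambda>n. small_times (1 / Suc n) x)"
    unfolding decseq_def by (force simp: mem_orbit_times)
  then obtain A where A: "A \<in> sets lebesgue" "A \<subseteq> \<Delta>" "upper_density \<alpha> A = 1"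
    "\<And>n. \<exists>R. A - small_times (1 / Suc n) x \<subseteq> ball 0 R"
    using upper_density_diagonal[of "\<lambda>n. small_times (1 / Suc n) x"] small sets_orbit_times by blast
  have "decseq (\<lambda>n. large_times (real n) x)"
    unfolding decseq_def by (force simp: mem_orbit_times)
  then obtain B where B: "B \<in> sets lebesgue" "B \<subseteq> \<Delta>" "upper_density \<alpha> B = 1"
    "\<And>n. \<exists>R. B - large_times (real n) x \<subseteq> ball 0 R"
    using upper_density_diagonal[of "\<lambda>n. large_times (real n) x"] large sets_orbit_times by blast
  have "((\<lambda>t. norm (T t x)) \<longlongrightarrow> 0) (at_infinity_in A)"
  proof (rule order_tendstoI)
    fix \<epsilon> :: real assume "0 < \<epsilon>"
    then obtain n where n: "1 / real (Suc n) < \<epsilon>" by (meson nat_approx_posE)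
    obtain R where "A - small_times (1 / Suc n) x \<subseteq> ball 0 R" using A(4) by blast
    with n show "\<forall>\<^sub>F t in at_infinity_in A. norm (T t x) < \<epsilon>"
      unfolding eventually_at_infinity_in by (intro exI[of _ R]) (force simp: mem_orbit_times)
  qed (auto intro!: always_eventually less_le_trans[OF _ norm_ge_zero])
  moreover have "filterlim (\<lambda>t. norm (T t x)) at_top (at_infinity_in B)"
    unfolding filterlim_at_top
  proof
    fix Z :: real
    obtain n where n: "Z \<le> real n" using real_arch_simple by blast
    obtain R where "B - large_times (real n) x \<subseteq> ball 0 R" using B(4) by blast
    with n show "\<forall>\<^sub>F t in at_infinity_in B. Z \<le> norm (T t x)"
      unfolding eventually_at_infinity_in by (intro exI[of _ R]) (force simp: mem_orbit_times)
  qed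
  ultimately show ?thesis unfolding dist_irregular_def using A B by blast
qed

section \<open>Small perturbations with large orbits\<close>

text \<open>
  Put \<open>z = C T\<^sub>s x\<close>, small in norm but with \<open>\<parallel>T\<^sub>t z\<parallel> > 2 c N\<close> for most \<open>t\<close>. At each such \<open>t\<close>, at most one of the
  vectors \<open>y + (j/N) z\<close> with \<open>j < N\<close> has an orbit value of norm at most \<open>c\<close>, so for some \<open>j\<close> these
  exceptional times fill at most the fraction \<open>1/N\<close> of \<open>\<Delta>\<^sub>r\<close>.
\<close>

lemma exists_large_perturbation:
  assumes \<delta>: "\<delta> > 0" and large: "upper_density \<alpha> (large_times \<delta> x) = 1"
    and small: "\<And>\<epsilon>. \<epsilon> > 0 \<Longrightarrow> upper_density \<alpha> (small_times \<epsilon> x) = 1"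
    and e: "e > 0" and \<eta>: "\<eta> > 0" and c: "c \<ge> 0"
  obtains s a r where "s \<in> \<Delta>" "norm (a *\<^sub>R T s x) < e" "r > R"
    "(1 - \<eta>) * \<mu> (\<Delta>\<^sub>r r) < \<mu> (large_times c (y + a *\<^sub>R T s x) \<inter> \<Delta>\<^sub>r r)"
proof -
  \<comment> \<open>This gives \<open>1 / N \<le> \<eta>/2\<close>; the other half of
    \<open>\<eta>\<close> is reserved for the times outside \<open>W\<close>.\<close>
  obtain N :: nat where N: "N > 2 / \<eta>" using reals_Archimedean2 by blast
  have N0: "N > 0" using N \<eta> by (metis divide_pos_pos gr0I less_trans of_nat_0 order_less_irrefl zero_less_numeral)
  \<comment> \<open>Chosen so that \<open>C * \<delta>\<close> exceeds
    \<open>2 * c * N\<close>.\<close>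
  define C where "C = (2 * c * N + 1) / \<delta>"
  have C: "C > 0" using c \<delta> by (auto simp: C_def intro!: divide_pos_pos add_nonneg_pos)
  obtain s where s: "s \<in> small_times (e / C) x"
  proof -
    have "small_times (e / C) x \<noteq> {}"
      using small[of "e / C"] e C upper_density_empty by auto
    then show ?thesis using that by blast
  qed
  then have s\<Delta>: "s \<in> \<Delta>" and ns: "C * norm (T s x) < e" using C by (auto simp: mem_orbit_times field_simps)
  define z where "z = C *\<^sub>R T s x"
  define W where "W = large_times \<delta> (T s x)"
  have W: "upper_density \<alpha> W = 1"
    unfolding W_def by (rule upper_density_translate[OF large sets_orbit_times s\<Delta> sets_orbit_times])
      (auto simp: mem_orbit_times T_add s\<Delta>)
  then obtain r where r: "r > max R 0" "(1 - \<eta>/2) * \<mu> (\<Delta>\<^sub>r r) < \<mu> (W \<inter> \<Delta>\<^sub>r r)"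
    using \<eta> unfolding upper_density_eq_1_iff by (meson half_gt_zero)
  define L where "L j = large_times c (y + (j / N) *\<^sub>R z)" for j :: nat
  define D where "D j = (W \<inter> \<Delta>\<^sub>r r) - L j" for j
  have mD: "D j \<in> lmeasurable" for j
    unfolding D_def W_def L_def using lmeasurable_Int_sector_below[OF sets_orbit_times] sets_orbit_times
    by (intro fmeasurable_Diff) auto
  have disj: "disjoint_family_on D {..<N}"
    unfolding disjoint_family_on_def
  proof (intro ballI impI, rule ccontr)
    fix i j assume ij: "i \<noteq> j" "D i \<inter> D j \<noteq> {}"
    then obtain t where t: "t \<in> D i" "t \<in> D j" by blast
    then have t\<Delta>: "t \<in> \<Delta>" by (simp add: D_def sector_below_def)
    have le: "norm (T t y + (k / N) *\<^sub>R T t z) \<le> c" if "t \<in> D k" for k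
      using that t\<Delta> by (simp add: D_def L_def mem_orbit_times linear_add linear_scale linear_T)
    \<comment> \<open>If two of the vectors were both not large at time \<open>t\<close>, their
      difference would have norm at most \<open>2 * c\<close>. The coefficients differ by at least
      \<open>1 / N\<close>, so \<open>T t z\<close> would be too short for a time in
      \<open>W\<close>.\<close>
    have "norm ((i / N - j / N) *\<^sub>R T t z) \<le> 2 * c"
      using le[OF t(1)] le[OF t(2)] norm_triangle_ineq4[of "T t y + (i / N) *\<^sub>R T t z" "T t y + (j / N) *\<^sub>R T t z"]
      by (simp add: scaleR_diff_left)
    then have "\<bar>real i - real j\<bar> * norm (T t z) \<le> 2 * c * N"
      using N0 by (simp add: field_simps flip: diff_divide_distrib)
    moreover have "\<bar>real i - real j\<bar> \<ge> 1" using ij by linarith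
    ultimately have "norm (T t z) \<le> 2 * c * N"
      using mult_right_mono[of 1 "\<bar>real i - real j\<bar>" "norm (T t z)"] by simp
    moreover have "norm (T t z) > C * \<delta>"
      using t C t\<Delta> by (simp add: D_def W_def z_def mem_orbit_times linear_scale linear_T)
    ultimately show False using \<delta> by (simp add: C_def)
  qed
  \<comment> \<open>Pigeonhole: the \<open>N\<close> disjoint sets \<open>D j\<close> all lie in
    \<open>\<Delta>\<^sub>r r\<close>.\<close>
  have "\<exists>j<N. \<mu> (D j) \<le> \<mu> (\<Delta>\<^sub>r r) / N"
  proof (rule ccontr)
    assume "\<not> ?thesis"
    then have gt: "\<mu> (\<Delta>\<^sub>r r) / N < \<mu> (D j)" if "j < N" for j using that by auto
    have "\<mu> (\<Delta>\<^sub>r r) = (\<Sum>j<N. \<mu> (\<Delta>\<^sub>r r) / N)" using N0 by simp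
    also have "\<dots> < (\<Sum>j<N. \<mu> (D j))" using gt N0 by (intro sum_strict_mono) auto
    also have "\<dots> = \<mu> (\<Union>j<N. D j)"
      using fmeasurableD[OF mD] fmeasurableD2[OF mD] disj
      by (intro measure_finite_Union[symmetric]) (simp_all add: image_subset_iff)
    also have "\<dots> \<le> \<mu> (\<Delta>\<^sub>r r)"
    proof (intro measure_mono_fmeasurable lmeasurable_sector_below)
      show "(\<Union>j<N. D j) \<subseteq> \<Delta>\<^sub>r r" by (auto simp: D_def)
      show "(\<Union>j<N. D j) \<in> sets lebesgue" using mD by (auto simp: fmeasurableD)
    qed
    finally show False by simp
  qed
  then obtain j where j: "j < N" "\<mu> (D j) \<le> \<mu> (\<Delta>\<^sub>r r) / N" by blast
  have "\<mu> (W \<inter> \<Delta>\<^sub>r r) \<le> \<mu> ((L j \<inter> \<Delta>\<^sub>r r) \<union> D j)"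
    using mD lmeasurable_Int_sector_below[OF sets_orbit_times]
    by (intro measure_mono_fmeasurable) (auto simp: D_def L_def W_def fmeasurableD fmeasurable.Un)
  also have "\<dots> \<le> \<mu> (L j \<inter> \<Delta>\<^sub>r r) + \<mu> (D j)"
    using mD lmeasurable_Int_sector_below[OF sets_orbit_times]
    by (intro measure_Un_le) (auto simp: L_def fmeasurableD)
  finally have "(1 - \<eta>/2) * \<mu> (\<Delta>\<^sub>r r) < \<mu> (L j \<inter> \<Delta>\<^sub>r r) + \<mu> (\<Delta>\<^sub>r r) / N" using r j by simp
  moreover have "\<mu> (\<Delta>\<^sub>r r) / N \<le> \<eta>/2 * \<mu> (\<Delta>\<^sub>r r)"
  proof -
    have "1 / N \<le> \<eta>/2" using N N0 \<eta> by (simp add: field_simps)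
    then have "1 / N * \<mu> (\<Delta>\<^sub>r r) \<le> \<eta>/2 * \<mu> (\<Delta>\<^sub>r r)" by (intro mult_right_mono) auto
    then show ?thesis by simp
  qed
  ultimately have "(1 - \<eta>) * \<mu> (\<Delta>\<^sub>r r) < \<mu> (L j \<inter> \<Delta>\<^sub>r r)" by (simp add: algebra_simps)
  moreover have "norm ((j / N * C) *\<^sub>R T s x) < e"
  proof -
    have "norm ((j / N * C) *\<^sub>R T s x) = j / N * (C * norm (T s x))" using C by simp
    also have "\<dots> \<le> 1 * (C * norm (T s x))" using j C by (intro mult_right_mono) auto
    finally show ?thesis using ns by simp
  qed
  ultimately show ?thesis using s\<Delta> r by (intro that[of s "j / N * C" r]) (auto simp: L_def z_def)
qed

section \<open>The invariant subspace and the Baire argument\<close>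

text \<open>
  A substitute for the linear span of the orbit of \<open>x\<close>: an invariant subspace containing the
  orbit, on which smallness of the orbits is inherited from \<open>x\<close> at the same times.
\<close>

definition dominated :: "'a \<Rightarrow> 'a set" where
  "dominated x = {y. \<exists>C. \<forall>t\<in>\<Delta>. norm (T t y) \<le> C * norm (T t x)}"

lemma subspace_dominated: "module.subspace smul (dominated x)"
proof (rule subspaceI)
  show "0 \<in> dominated x"
    by (auto simp: dominated_def linear_0 linear_T intro!: exI[of _ 0])
  show "y + z \<in> dominated x" if y: "y \<in> dominated x" and z: "z \<in> dominated x" for y z
  proof -
    obtain C C' where C: "\<And>t. t \<in> \<Delta> \<Longrightarrow> norm (T t y) \<le> C * norm (T t x)"
       "\<And>t. t \<in> \<Delta> \<Longrightarrow> norm (T t z) \<le> C' * norm (T t x)"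
      using y z unfolding dominated_def by blast
    have "norm (T t (y + z)) \<le> (C + C') * norm (T t x)" if "t \<in> \<Delta>" for t
      using C[OF that] norm_triangle_ineq[of "T t y" "T t z"] that
      by (simp add: linear_add linear_T distrib_right)
    then show ?thesis unfolding dominated_def by blast
  qed
  show "smul c y \<in> dominated x" if y: "y \<in> dominated x" for c y
  proof -
    obtain C where C: "\<And>t. t \<in> \<Delta> \<Longrightarrow> norm (T t y) \<le> C * norm (T t x)"
      using y unfolding dominated_def by blast
    have "norm (T t (smul c y)) \<le> (norm c * C) * norm (T t x)" if "t \<in> \<Delta>" for t
      using mult_left_mono[OF C[OF that], of "norm c"] that by (simp add: T_smul norm_scale mult_ac)
    then show ?thesis unfolding dominated_def by blast
  qed
qed

text \<open>\<open>T s\<close> commutes with every \<open>T t\<close> and is bounded, so the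
  domination constant is merely multiplied by \<open>M\<close>.\<close>

lemma T_dominated: 
  assumes "s \<in> \<Delta>" "y \<in> dominated x"
  shows "T s y \<in> dominated x"
proof -
  obtain C where C: "\<And>t. t \<in> \<Delta> \<Longrightarrow> norm (T t y) \<le> C * norm (T t x)"
    using assms unfolding dominated_def by blast
  obtain M where M: "M > 0" "\<And>x. norm (T s x) \<le> M * norm x"
    using T_bounded_on_bounded[of "norm s"] assms(1) by (metis order_refl)
  have "norm (T t (T s y)) \<le> (M * C) * norm (T t x)" if "t \<in> \<Delta>" for t
    using order_trans[OF M(2) mult_left_mono[OF C[OF that] less_imp_le[OF M(1)]]]
    by (simp add: T_commute[OF that assms(1)] mult.assoc)
  then show ?thesis unfolding dominated_def by blast
qed

lemma T_closure_dominated: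
  assumes "s \<in> \<Delta>"
  shows "T s ` closure (dominated x) \<subseteq> closure (dominated x)"
proof -
  have "T s ` closure (dominated x) \<subseteq> closure (T s ` dominated x)"
    using continuous_T[OF assms] 
    by (intro image_closure_subset[OF continuous_on_subset]) (auto intro: closure_subset[THEN subsetD])
  also have "\<dots> \<subseteq> closure (dominated x)"
    using T_dominated[OF assms] by (intro closure_mono) auto
  finally show ?thesis .
qed

lemma has_dense_gdelta_dist_irregular_closure_dominated:
  assumes "chaotic_vector x"
  shows "has_dense_gdelta_dist_irregular \<alpha> T (closure (dominated x))"
proof -
  define Y where "Y = closure (dominated x)"
  obtain \<delta> where \<delta>: "\<delta> > 0" "\<And>\<epsilon>. \<epsilon> > 0 \<Longrightarrow> upper_density \<alpha> (small_times \<epsilon> x) = 1"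
    "upper_density \<alpha> (large_times \<delta> x) = 1" using assms by (auto simp: chaotic_vector_def)
  \<comment> \<open>Asking for a single radius beyond \<open>n\<close> with fraction above
    \<open>1 - 1 / Suc n\<close> is an open condition; imposing it for all \<open>n\<close> recovers
    upper density one.\<close>
  define O' where "O' \<sigma> c n = {y. \<exists>r>real n. (1 - 1 / Suc n) * \<mu> (\<Delta>\<^sub>r r) < \<mu> (orbit_times \<sigma> c y \<inter> \<Delta>\<^sub>r r)}"
    for \<sigma> c :: real and n :: nat
  have opO: "open (O' \<sigma> c n)" if "\<bar>\<sigma>\<bar> = 1" for \<sigma> c n
  proof -
    have "O' \<sigma> c n = (\<Union>r\<in>{real n<..}. {y. (1 - 1 / Suc n) * \<mu> (\<Delta>\<^sub>r r) < \<mu> (orbit_times \<sigma> c y \<inter> \<Delta>\<^sub>r r)})"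
      by (auto simp: O'_def)
    then show ?thesis using open_orbit_times_measure_greater[OF that] by auto
  qed
  define V where "V n = O' 1 (1 / Suc n) n" for n
  define U where "U n = O' (-1) (- real n) n" for n
  have V: "dominated x \<subseteq> V n" for n
  proof
    fix y assume "y \<in> dominated x"
    then obtain C where C: "\<And>t. t \<in> \<Delta> \<Longrightarrow> norm (T t y) \<le> C * norm (T t x)"
      unfolding dominated_def by blast
    \<comment> \<open>A positive constant, so that thresholds can be divided by it.\<close>
    define C' where "C' = max C 1"
    have C': "norm (T t y) \<le> C' * norm (T t x)" if "t \<in> \<Delta>" for t
      using C[OF that] mult_right_mono[of C C' "norm (T t x)"] by (simp add: C'_def)
    have C'0: "C' > 0" by (simp add: C'_def)
    define \<epsilon> where "\<epsilon> = 1 / Suc n / C'"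
    have "\<epsilon> > 0" using C'0 by (simp add: \<epsilon>_def)
    from \<delta>(2)[OF this] have "upper_density \<alpha> (small_times (1 / Suc n) y) = 1"
    proof (rule upper_density_eq_1_almost_mono)
      have "norm (T t y) < 1 / Suc n" if "t \<in> small_times \<epsilon> x" for t
      proof -
        have t: "t \<in> \<Delta>" "norm (T t x) < \<epsilon>" using that by (auto simp: mem_orbit_times)
        have "C' * norm (T t x) < C' * \<epsilon>" using t C'0 by simp
        also have "\<dots> = 1 / Suc n" using C'0 by (simp add: \<epsilon>_def)
        finally show ?thesis using C'[OF t(1)] by simp
      qed
      \<comment> \<open>The ball of radius 0 is empty: here the inclusion has no exceptional
        times.\<close>
      then show "small_times \<epsilon> x \<inter> \<Delta> - small_times (1 / Suc n) y \<subseteq> ball 0 0"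
        by (auto simp: mem_orbit_times)
    qed (rule sets_orbit_times)+
    then show "y \<in> V n" unfolding V_def O'_def upper_density_eq_1_iff by simp
  qed
  have subY: "subspace Y" unfolding Y_def by (intro subspace_closure subspace_dominated)
  have U: "Y \<subseteq> closure (Y \<inter> U n)" for n
  proof
    fix y assume y: "y \<in> Y"
    show "y \<in> closure (Y \<inter> U n)"
      unfolding closure_approachable
    proof (intro allI impI)
      fix e :: real assume e: "e > 0"
      have "(0::real) < 1 / Suc n" by simp
      from exists_large_perturbation[OF \<delta>(1,3,2) e this of_nat_0_le_iff]
      obtain s a r where *: "s \<in> \<Delta>" "norm (a *\<^sub>R T s x) < e" "r > real n"
        "(1 - 1 / Suc n) * \<mu> (\<Delta>\<^sub>r r) < \<mu> (large_times (real n) (y + a *\<^sub>R T s x) \<inter> \<Delta>\<^sub>r r)"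
        by blast
      have "x \<in> dominated x" unfolding dominated_def by (auto intro: exI[of _ 1])
      then have "T s x \<in> Y" using T_dominated[OF *(1)] closure_subset by (force simp: Y_def)
      then have "y + a *\<^sub>R T s x \<in> Y"
        using subspace_add[OF subY y subspace_scale[OF subY]] by (metis scale_of_real)
      moreover have "y + a *\<^sub>R T s x \<in> U n" using * by (auto simp: U_def O'_def)
      ultimately show "\<exists>y'\<in>Y \<inter> U n. dist y' y < e" using *(2)
        by (intro bexI[of _ "y + a *\<^sub>R T s x"]) (auto simp: dist_norm)
    qed
  qed
  let ?X = "top_of_set Y"
  let ?\<G> = "range (\<lambda>n. Y \<inter> U n) \<union> range (\<lambda>n. Y \<inter> V n)"
  have dense: "?X closure_of S = Y" if "S \<subseteq> Y" "Y \<subseteq> closure S" for S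
    using that by (auto simp: closure_of_subtopology Int_absorb1)
  have \<G>: "openin ?X S \<and> ?X closure_of S = topspace ?X" if "S \<in> ?\<G>" for S
  proof -
    have "Y \<subseteq> closure (Y \<inter> V n)" for n
      unfolding Y_def using V[of n] closure_subset by (intro closure_mono) blast
    then show ?thesis using that opO U by (auto simp: U_def V_def dense openin_open_Int)
  qed
  have "?X closure_of \<Inter>?\<G> = topspace ?X"
  proof (rule Baire_category)
    have "closed Y" by (simp add: Y_def)
    then show "completely_metrizable_space ?X \<or> locally_compact_space ?X \<and> regular_space ?X"
      using completely_metrizable_space_closedin completely_metrizable_space_euclidean closed_closedin by blast
  qed (use \<G> in auto)
  moreover have "gdelta_in ?X (\<Inter>?\<G>)"
    using \<G> by (intro gdelta_in_Inter open_imp_gdelta_in) auto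
  moreover have "dist_irregular \<alpha> T y" if "y \<in> \<Inter>?\<G>" for y
  proof -
    \<comment> \<open>The thresholds become stricter as \<open>n\<close> grows, so a fixed level
      \<open>m\<close> is met by the time sets of all \<open>n \<ge> m\<close>, and this tail
      already supplies arbitrarily large radii and fractions close to 1.\<close>
    have "upper_density \<alpha> F = 1"
      if F: "\<And>n. n \<ge> m \<Longrightarrow> y \<in> O' \<sigma> (c n) n" "\<And>n. n \<ge> m \<Longrightarrow> orbit_times \<sigma> (c n) y \<subseteq> F" "F \<in> sets lebesgue"
      for F m \<sigma> c
      unfolding upper_density_eq_1_iff
    proof (intro allI impI)
      fix \<epsilon> R :: real assume \<epsilon>: "\<epsilon> > 0"
      obtain n :: nat where n: "n > max (max R m) (1 / \<epsilon>)" using reals_Archimedean2 by blast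
      have "y \<in> O' \<sigma> (c n) n" using F n by auto
      then obtain r where r: "r > real n" "(1 - 1 / Suc n) * \<mu> (\<Delta>\<^sub>r r) < \<mu> (orbit_times \<sigma> (c n) y \<inter> \<Delta>\<^sub>r r)"
        by (auto simp: O'_def)
      have "1 < real n * \<epsilon>" using n \<epsilon> by (simp add: field_simps)
      then have "1 / Suc n \<le> \<epsilon>" using \<epsilon> by (simp add: field_simps)
      then have "(1 - \<epsilon>) * \<mu> (\<Delta>\<^sub>r r) \<le> (1 - 1 / Suc n) * \<mu> (\<Delta>\<^sub>r r)" by (intro mult_right_mono) auto
      also note r(2)
      also have "\<mu> (orbit_times \<sigma> (c n) y \<inter> \<Delta>\<^sub>r r) \<le> \<mu> (F \<inter> \<Delta>\<^sub>r r)"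
        using F(2)[of n] F(3) n sets_orbit_times lmeasurable_Int_sector_below
        by (intro measure_mono_fmeasurable) (auto simp: fmeasurableD)
      finally show "\<exists>r>R. (1 - \<epsilon>) * \<mu> (\<Delta>\<^sub>r r) < \<mu> (F \<inter> \<Delta>\<^sub>r r)" using r n by (intro exI[of _ r]) auto
    qed
    note * = this
    have yU: "y \<in> O' (-1) (- real n) n" and yV: "y \<in> O' 1 (1 / Suc n) n" for n
      using that by (auto simp: U_def V_def)
    show ?thesis
    proof (rule dist_irregularI)
      fix m
      have "1 / real (Suc n) \<le> 1 / real (Suc m)" if "m \<le> n" for n
        using that by (simp add: field_simps)
      then show "upper_density \<alpha> (small_times (1 / Suc m) y) = 1"
        by (intro *[where m=m and c="\<lambda>n. 1 / Suc n", OF yV _ sets_orbit_times]) (force simp: mem_orbit_times)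
      show "upper_density \<alpha> (large_times (real m) y) = 1"
        by (intro *[where m=m and c="\<lambda>n. - real n", OF yU _ sets_orbit_times]) (force simp: mem_orbit_times)
    qed
  qed
  ultimately show ?thesis unfolding has_dense_gdelta_dist_irregular_def Y_def by auto
qed

end

section \<open>The cycle of implications\<close>

theorem theorem3p13:
  fixes smul :: "'k::real_normed_field \<Rightarrow> 'a::banach \<Rightarrow> 'a"
    and \<alpha> :: real and T :: "complex \<Rightarrow> 'a \<Rightarrow> 'a"
  assumes "banach_over smul"
    and "0 < \<alpha>" and "\<alpha> < pi / 2"
    and "C0_semigroup smul \<alpha> T"
  shows "((\<exists>x. dist_semi_irregular \<alpha> T x) \<longleftrightarrow> (\<exists>x. dist_irregular \<alpha> T x)) \<and>
         ((\<exists>x. dist_irregular \<alpha> T x) \<longleftrightarrow> dist_chaotic \<alpha> T) \<and>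
         (dist_chaotic \<alpha> T \<longleftrightarrow>
            (\<exists>Y. closed Y \<and> module.subspace smul Y \<and> invariant \<alpha> T Y \<and>
                 has_dense_gdelta_dist_irregular \<alpha> T Y))"
    (is "(?semi \<longleftrightarrow> ?irregular) \<and> (_ \<longleftrightarrow> ?chaotic) \<and> (_ \<longleftrightarrow> ?subspace)")
proof -
  interpret banach_over smul by (rule assms)
  interpret C0_sector_semigroup \<alpha> smul T by unfold_locales (use assms in auto)
  have 1: "?semi \<longrightarrow> ?chaotic"
    using dist_semi_irregular_imp_chaotic_vector by (auto simp: dist_chaotic_iff)
  have 2: "?chaotic \<longrightarrow> ?subspace"
  proof
    assume ?chaotic
    then obtain x where x: "chaotic_vector x" by (auto simp: dist_chaotic_iff)
    have "invariant \<alpha> T (closure (dominated x))"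
      using T_closure_dominated by (auto simp: invariant_def)
    then show ?subspace
      using has_dense_gdelta_dist_irregular_closure_dominated[OF x]
        subspace_closure[OF subspace_dominated] closed_closure by blast
  qed
  have 3: "?subspace \<longrightarrow> ?irregular"
  proof
    assume ?subspace
    then obtain Y G where Y: "subspace Y" and G: "top_of_set Y closure_of G = Y"
      "\<forall>x\<in>G. dist_irregular \<alpha> T x" unfolding has_dense_gdelta_dist_irregular_def by blast
    \<comment> \<open>The closure of the empty set is empty, whereas \<open>Y\<close> contains
      0.\<close>
    have "G \<noteq> {}" using G(1) subspace_0[OF Y] by auto
    with G(2) show ?irregular by blast
  qed
  have 4: "?irregular \<longrightarrow> ?semi"
    using dist_irregular_imp_dist_semi_irregular by blast
  show ?thesis using 1 2 3 4 by argo
qed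

end
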